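(* Let $(A_m)_{m\ge 0}$ be a sequence of real numbers such that $\sum_{m\ge 0}\frac{A_m}{m!}x^m$ converges for every real $x$, and put $f(x)=e^{-x}\sum_{m=0}^{\infty}\frac{A_m}{m!}x^m$. Then for every $R>0$ and every integer $n\ge1$, \[ A_n-f(R)=\sum_{m=0}^{n-1}\frac{\Delta A_m}{m!}\int_R^\infty e^{-t}t^m\,dt-\sum_{m=n}^{\infty}\frac{\Delta A_m}{m!}\int_0^R e^{-t}t^m\,dt, \] where $\Delta A_m=A_{m+1}-A_m$. *)

theory Defs
  imports "HOL-Analysis.Analysis"
begin

end

theory Submission
  imports Defs
begin

text \<open>
  Both incomplete Gamma integrals are Poisson probabilities: with
  \<open>P m R = (\<Sum>k\<le>m. exp (- R) * R ^ k / fact k)\<close> the integral over \<open>{R..}\<close> is \<open>fact m * P m R\<close>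
  and the one over \<open>{0..R}\<close> is \<open>fact m * (1 - P m R)\<close>. Hence the two sums differ from
  \<open>\<Sum>m<n. \<Delta>A m = A n - A 0\<close> by \<open>\<Sum>m. \<Delta>A m * (1 - P m R)\<close> over all \<open>m\<close>, which summation by parts
  evaluates to \<open>f R - A 0\<close>; the boundary term \<open>A N * (1 - P N R)\<close> vanishes in the limit
  because \<open>1 - P N R \<le> R * R ^ N / fact N\<close>.
\<close>

definition poisson_cdf :: "nat \<Rightarrow> real \<Rightarrow> real" where
  "poisson_cdf m t = (\<Sum>k\<le>m. exp (- t) * t ^ k / fact k)"

lemma poisson_cdf_Suc:
  "poisson_cdf (Suc m) t = poisson_cdf m t + exp (- t) * t ^ Suc m / fact (Suc m)"
  by (simp add: poisson_cdf_def)

lemma poisson_cdf_0_right [simp]: "poisson_cdf m 0 = 1"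
  by (induction m) (simp_all add: poisson_cdf_Suc, simp add: poisson_cdf_def)

text \<open>The derivative of each Poisson weight is the previous weight minus the weight itself, so
  the sum telescopes and only the top weight survives.\<close>

lemma has_real_derivative_poisson_cdf:
  "(poisson_cdf m has_real_derivative - (exp (- t) * t ^ m / fact m)) (at t)"
proof (induction m)
  case 0
  then show ?case
    unfolding poisson_cdf_def by (auto intro!: derivative_eq_intros)
next
  case (Suc m)
  have "((\<lambda>t. exp (- t) * t ^ Suc m / fact (Suc m)) has_real_derivative
      exp (- t) * t ^ m / fact m - exp (- t) * t ^ Suc m / fact (Suc m)) (at t)"
    by (rule derivative_eq_intros refl | simp add: divide_simps)+
  from DERIV_add[OF Suc this] show ?case
    by (simp add: poisson_cdf_Suc[abs_def])
qed

lemma poisson_cdf_at_top: "(poisson_cdf m \<longlongrightarrow> 0) at_top"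
proof -
  have "((\<lambda>t::real. \<Sum>k\<le>m. t ^ k / exp t / fact k) \<longlongrightarrow> (\<Sum>k\<le>m. 0 / fact k)) at_top"
    by (intro tendsto_intros tendsto_power_div_exp_0) auto
  then show ?thesis
    by (simp add: poisson_cdf_def[abs_def] exp_minus field_simps)
qed

lemma has_integral_exp_minus_power:
  assumes "a \<le> b"
  shows "((\<lambda>t::real. exp (- t) * t ^ m) has_integral
    fact m * (poisson_cdf m a - poisson_cdf m b)) {a..b}"
proof -
  have "((\<lambda>t. - fact m * poisson_cdf m t) has_real_derivative exp (- t) * t ^ m) (at t within {a..b})" for t
    using DERIV_cmult[OF has_real_derivative_poisson_cdf[of m t], of "- fact m"]
    by (auto intro: has_field_derivative_at_within)
  then have "((\<lambda>t. exp (- t) * t ^ m) has_integral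
      - fact m * poisson_cdf m b - - fact m * poisson_cdf m a) {a..b}"
    using assms
    by (intro fundamental_theorem_of_calculus) (auto simp flip: has_real_derivative_iff_has_vector_derivative)
  then show ?thesis
    by (simp add: algebra_simps)
qed

lemma integral_0_exp_minus_power:
  assumes "0 \<le> R"
  shows "integral {0..R} (\<lambda>t::real. exp (- t) * t ^ m) = fact m * (1 - poisson_cdf m R)"
  using has_integral_exp_minus_power[OF assms] by (simp add: integral_unique)

lemma integral_exp_minus_power_to_infinity:
  assumes "0 \<le> R"
  shows "integral {R..} (\<lambda>t::real. exp (- t) * t ^ m) = fact m * poisson_cdf m R"
\<comment> \<open>The integrand is nonnegative on \<open>{R..}\<close> because
  \<open>0 \<le> R\<close>, so the improper integral is the limit of the integrals over
  \<open>{R..y}\<close>.\<close>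
proof (rule integral_unique, rule has_integral_to_inf)
  show "(\<lambda>t. exp (- t) * t ^ m) integrable_on {R..y}" for y
    by (intro integrable_continuous_interval continuous_intros)
  have "\<forall>\<^sub>F y in at_top. fact m * (poisson_cdf m R - poisson_cdf m y)
      = integral {R..y} (\<lambda>t. exp (- t) * t ^ m)"
    using eventually_ge_at_top[of R]
    by eventually_elim (simp add: integral_unique[OF has_integral_exp_minus_power])
  moreover have "((\<lambda>y. fact m * (poisson_cdf m R - poisson_cdf m y)) \<longlongrightarrow>
      fact m * (poisson_cdf m R - 0)) at_top"
    by (intro tendsto_intros poisson_cdf_at_top)
  ultimately show "((\<lambda>y. integral {R..y} (\<lambda>t. exp (- t) * t ^ m)) \<longlongrightarrow>
      fact m * poisson_cdf m R) at_top"
    by (simp add: tendsto_cong)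
qed (use assms in auto)

text \<open>The complement is a nonnegative integral divided by \<open>fact m\<close>. This removes
  the absolute value in the later tail estimate.\<close>

lemma poisson_cdf_le_1:
  assumes "0 \<le> R"
  shows "poisson_cdf m R \<le> 1"
proof -
  have "0 \<le> integral {0..R} (\<lambda>t. exp (- t) * t ^ m) / fact m"
    by (rule divide_nonneg_pos)
      (auto intro!: integral_nonneg integrable_continuous_interval continuous_intros)
  then show ?thesis
    using assms by (simp add: integral_0_exp_minus_power)
qed

text \<open>On \<open>{0..R}\<close> the integrand is at most \<open>R ^ m\<close>. The bound is
  grouped so that multiplying by \<open>\<bar>A m\<bar>\<close> gives \<open>R\<close> times the
  absolute value of a term of the series at \<open>R\<close>.\<close>

lemma poisson_tail_le:
  assumes "0 \<le> R"
  shows "1 - poisson_cdf m R \<le> R * (R ^ m / fact m)"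
proof -
  have "exp (- t) * t ^ m \<le> R ^ m" if "t \<in> {0..R}" for t
    using mult_mono[of "exp (- t)" 1 "t ^ m" "R ^ m"] that by (simp add: power_mono)
  then have "integral {0..R} (\<lambda>t. exp (- t) * t ^ m) \<le> integral {0..R} (\<lambda>t. R ^ m)"
    by (intro integral_le) (auto intro!: integrable_continuous_interval continuous_intros)
  then have "fact m * (1 - poisson_cdf m R) \<le> R * R ^ m"
    using assms by (simp add: integral_0_exp_minus_power)
  then show ?thesis
    by (simp add: field_simps)
qed

text \<open>Summation by parts: passing from \<open>N\<close> to \<open>Suc N\<close> lowers the
  tail by one Poisson weight, and \<open>A (Suc N)\<close> times that weight is the new term of the
  series.\<close>

lemma sum_diff_poisson_tail:
  "(\<Sum>m<N. (A (Suc m) - A m) * (1 - poisson_cdf m R))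
    = A N * (1 - poisson_cdf N R) - A 0 + exp (- R) * (\<Sum>m\<le>N. A m / fact m * R ^ m)"
proof (induction N)
  case 0
  then show ?case
    by (simp add: poisson_cdf_def algebra_simps)
next
  case (Suc N)
  show ?case
    unfolding sum.lessThan_Suc sum.atMost_Suc Suc.IH poisson_cdf_Suc
    by (simp add: algebra_simps)
qed

lemma sums_diff_poisson_tail:
  assumes sm: "summable (\<lambda>m. A m / fact m * R ^ m)" and "0 \<le> R"
  shows "(\<lambda>m. (A (Suc m) - A m) * (1 - poisson_cdf m R)) sums
    (exp (- R) * (\<Sum>m. A m / fact m * R ^ m) - A 0)"
proof -
  \<comment> \<open>Terms of a convergent series tend to zero; this majorant kills the boundary
    term.\<close>
  have "(\<lambda>N. R * \<bar>A N / fact N * R ^ N\<bar>) \<longlonglongrightarrow> 0"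
    using tendsto_mult_right_zero[OF tendsto_rabs_zero[OF summable_LIMSEQ_zero[OF sm]]] .
  moreover have "\<forall>\<^sub>F N in sequentially. norm (A N * (1 - poisson_cdf N R)) \<le> R * \<bar>A N / fact N * R ^ N\<bar>"
  proof (intro always_eventually allI)
    fix N
    show "norm (A N * (1 - poisson_cdf N R)) \<le> R * \<bar>A N / fact N * R ^ N\<bar>"
      using mult_left_mono[OF poisson_tail_le[OF \<open>0 \<le> R\<close>, of N], of "\<bar>A N\<bar>"]
        poisson_cdf_le_1[OF \<open>0 \<le> R\<close>, of N] \<open>0 \<le> R\<close>
      by (simp add: abs_mult mult_ac)
  qed
  ultimately have "(\<lambda>N. A N * (1 - poisson_cdf N R)) \<longlonglongrightarrow> 0"
    by (rule Lim_null_comparison[rotated])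
  then have "(\<lambda>N. A N * (1 - poisson_cdf N R) - A 0 + exp (- R) * (\<Sum>m\<le>N. A m / fact m * R ^ m))
      \<longlonglongrightarrow> 0 - A 0 + exp (- R) * (\<Sum>m. A m / fact m * R ^ m)"
    by (intro tendsto_intros summable_LIMSEQ' sm)
  then show ?thesis
    by (simp add: sums_def sum_diff_poisson_tail)
qed

theorem theorem6:
  fixes A :: "nat \<Rightarrow> real" and f :: "real \<Rightarrow> real" and R :: real and n :: nat
  assumes conv: "\<And>x::real. summable (\<lambda>m. A m / fact m * x ^ m)"
    and f_def: "\<And>x::real. f x = exp (- x) * (\<Sum>m. A m / fact m * x ^ m)"
    and R: "R > 0"
    and n: "n \<ge> 1"
  defines "\<Delta>A \<equiv> \<lambda>m. A (m + 1) - A m"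
  shows "summable (\<lambda>k. \<Delta>A (n + k) / fact (n + k) * integral {0..R} (\<lambda>t. exp (- t) * t ^ (n + k))) \<and>
    A n - f R =
      (\<Sum>m<n. \<Delta>A m / fact m * integral {R..} (\<lambda>t. exp (- t) * t ^ m))
      - (\<Sum>k. \<Delta>A (n + k) / fact (n + k) * integral {0..R} (\<lambda>t. exp (- t) * t ^ (n + k)))"
proof -
  define Q where "Q m = \<Delta>A m * (1 - poisson_cdf m R)" for m
  have "Q sums (f R - A 0)"
    using sums_diff_poisson_tail[OF conv[of R]] R by (simp add: Q_def[abs_def] \<Delta>A_def f_def)
  then have sumQ: "(\<lambda>k. Q (n + k)) sums (f R - A 0 - (\<Sum>m<n. Q m))"
    by (subst add.commute) (rule sums_split_initial_segment)
  have lower: "\<Delta>A m / fact m * integral {0..R} (\<lambda>t. exp (- t) * t ^ m) = Q m" for m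
    using R by (simp add: integral_0_exp_minus_power Q_def)
  have upper: "\<Delta>A m / fact m * integral {R..} (\<lambda>t. exp (- t) * t ^ m) = \<Delta>A m - Q m" for m
    using R by (simp add: integral_exp_minus_power_to_infinity Q_def right_diff_distrib)
  have "(\<Sum>m<n. \<Delta>A m) = A n - A 0"
    by (simp add: \<Delta>A_def sum_lessThan_telescope)
  \<comment> \<open>The finite sum is \<open>A n - A 0\<close> minus the first \<open>n\<close>
    values of \<open>Q\<close>, the series is \<open>f R - A 0\<close> minus the same values; on
    subtraction these and \<open>A 0\<close> cancel.\<close>
  with sums_summable[OF sumQ] sums_unique[OF sumQ] show ?thesis
    unfolding lower upper by (simp add: sum_subtractf)
qed

end
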